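(* Let $\mathcal L$ be a proto-Lagrangian. Suppose that for some linear $K:\mathbb C^{r\times c}\to\mathbb C^{r\times c}$ and some $a\in\mathbb R^N$ the following hold for all $P,Q_1,\dots,Q_N\in\mathbb C^{r\times c}$, all $x\in\mathbb R^N$ and $s\in\mathbb R$ with $|s|$ small: (internal symmetry) $$\mathcal L\big(e^{sK}P;(e^{sK}P)^\dagger;\dots,e^{sK}Q_\mu,\dots;\dots,(e^{sK}Q_\mu)^\dagger,\dots;x\big)=\mathcal L\big(P;P^\dagger;\dots,Q_\mu,\dots;\dots,Q_\mu^\dagger,\dots;x\big)+O(s^2);$$ (external symmetry) $$\mathcal L\big(P;P^\dagger;\dots,Q_\mu,\dots;\dots,Q_\mu^\dagger,\dots;x-sa\big)=\mathcal L\big(P;P^\dagger;\dots,Q_\mu,\dots;\dots,Q_\mu^\dagger,\dots;x\big)+O(s^2).$$ Then for any solution $\Psi$ of the Euler–Lagrange system one has the conservation law $$\sum_{\mu=1}^N\frac{\partial}{\partial x^\mu}\Big\{\mathrm{Tr}\Big[\mathcal L^{(\mu)}_\Psi\cdot\big(K\Psi-\textstyle\sum_\lambda a^\lambda\partial_\lambda\Psi\big)+\mathcal L^{(\mu\star)}_\Psi\cdot\big(K\Psi-\sum_\lambda a^\lambda\partial_\lambda\Psi\big)^\dagger\Big]+a^\mu\mathcal L_\Psi\Big\}=0 .$$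
   Context: Fix positive integers $N,r,c$; $^\dagger$ is the conjugate transpose. A proto-Lagrangian is a smooth function $\mathcal L:\mathbb C^{r\times c}\times\mathbb C^{c\times r}\times\mathbb C^{Nr\times c}\times\mathbb C^{c\times Nr}\times\mathbb R^N\to\mathbb C$, holomorphic in the matrix arguments, vanishing when these are all $0$, written $\mathcal L(P;Q^\top;\dots,R_\mu,\dots;\dots,S_\mu^\top,\dots;x)$ with $P,R_\mu\in\mathbb C^{r\times c}$, $Q^\top,S_\mu^\top\in\mathbb C^{c\times r}$, $1\le\mu\le N$. For a function $F$ of a matrix $Z\in\mathbb C^{p\times q}$, $\partial F/\partial Z$ is the $q\times p$ matrix with $(i,j)$ entry $\partial F/\partial Z_{ji}$. The complex partial derivatives of $\mathcal L$ with respect to $P,Q^\top,R_\mu,S_\mu^\top$ are $\mathcal L^{(o)},\mathcal L^{(o\star)},\mathcal L^{(\mu)},\mathcal L^{(\mu\star)}$. For smooth $\Psi:\mathbb R^N\to\mathbb C^{r\times c}$, $\mathcal L_\Psi(x)=\mathcal L(\Psi(x);\Psi^\dagger(x);\dots,\partial_\mu\Psi(x),\dots;\dots,\partial_\mu\Psi^\dagger(x),\dots;x)$, and $\mathcal L^{(o)}_\Psi$ etc. are the functions obtained by the same substitution. The Euler–Lagrange system is $$\mathcal L^{(o)}_\Psi-\sum_{\mu}\partial_\mu\mathcal L^{(\mu)}_\Psi=0,\qquad \mathcal L^{(o\star)}_\Psi-\sum_\mu\partial_\mu\mathcal L^{(\mu\star)}_\Psi=0$$ (these two equations are equivalent when the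 Lagrangian functional $\int\mathcal L_\Psi\,dx$ is real-valued). The constants in $O(s^2)$ (as $s\to0$) may depend on all the independent variables of $\mathcal L$. *)

theory Defs
  imports "HOL-Analysis.Analysis" "HOL-Library.Landau_Symbols"
begin

text \<open>
  The positive integers \<open>N, r, c\<close> are the cardinalities of finite index types \<open>'n, 'r, 'c\<close>.  An
  \<open>r \<times> c\<close> matrix has type \<open>complex^'c^'r\<close>, and a stack of \<open>N\<close> matrices is a vector of matrices
  indexed by \<open>'n\<close>.
\<close>

type_synonym ('n, 'r, 'c, 'v) jet_fun =
  "complex^'c^'r \<Rightarrow> complex^'r^'c \<Rightarrow> (complex^'c^'r)^'n \<Rightarrow> (complex^'r^'c)^'n \<Rightarrow> real^'n \<Rightarrow> 'v"

text \<open>On a finite-dimensional domain, requiring continuity of all iterated directional derivatives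
  is the usual notion of \<open>C\<^sup>k\<close>.\<close>

fun Ck :: "nat \<Rightarrow> ('a::real_normed_vector \<Rightarrow> 'b::real_normed_vector) \<Rightarrow> bool" where
  "Ck 0 f \<longleftrightarrow> continuous_on UNIV f"
| "Ck (Suc k) f \<longleftrightarrow>
     (\<forall>x. f differentiable (at x)) \<and> (\<forall>v. Ck k (\<lambda>x. frechet_derivative f (at x) v))"

definition smooth :: "('a::real_normed_vector \<Rightarrow> 'b::real_normed_vector) \<Rightarrow> bool" where
  "smooth f \<longleftrightarrow> (\<forall>k. Ck k f)"

definition dagger :: "complex^'q^'p \<Rightarrow> complex^'p^'q" where
  "dagger A = map_matrix cnj (transpose A)"

definition partial :: "'n \<Rightarrow> (real^'n \<Rightarrow> 'b::real_normed_vector) \<Rightarrow> real^'n \<Rightarrow> 'b" where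
  "partial \<mu> f x = vector_derivative (\<lambda>t. f (x + t *\<^sub>R axis \<mu> 1)) (at 0)"

text \<open>\<open>axis i (axis j t)\<close> is the matrix whose only nonzero entry is \<open>t\<close> in row \<open>i\<close>, column \<open>j\<close>.\<close>

definition mat_deriv :: "(complex^'q^'p \<Rightarrow> complex) \<Rightarrow> complex^'q^'p \<Rightarrow> complex^'p^'q" where
  "mat_deriv F Z = (\<chi> i j. deriv (\<lambda>t. F (Z + axis j (axis i t))) 0)"

text \<open>Holomorphy in each entry separately; together with joint continuity this is
  the definition of a holomorphic function of several complex variables.\<close>

definition entrywise_holomorphic :: "(complex^'q^'p \<Rightarrow> complex) \<Rightarrow> bool" where
  "entrywise_holomorphic F \<longleftrightarrow> (\<forall>Z i j. (\<lambda>t. F (Z + axis i (axis j t))) holomorphic_on UNIV)"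

definition vec_upd :: "'a^'n \<Rightarrow> 'n \<Rightarrow> 'a \<Rightarrow> 'a^'n" where
  "vec_upd R \<mu> Z = (\<chi> \<nu>. if \<nu> = \<mu> then Z else R $ \<nu>)"

definition proto_Lagrangian :: "('n::finite, 'r::finite, 'c::finite, complex) jet_fun \<Rightarrow> bool" where
  "proto_Lagrangian L \<longleftrightarrow>
     smooth (\<lambda>(P, Q, R, S, x). L P Q R S x) \<and>
     (\<forall>P Q R S x.
        entrywise_holomorphic (\<lambda>Z. L Z Q R S x) \<and>
        entrywise_holomorphic (\<lambda>Z. L P Z R S x) \<and>
        (\<forall>\<mu>. entrywise_holomorphic (\<lambda>Z. L P Q (vec_upd R \<mu> Z) S x)) \<and>
        (\<forall>\<mu>. entrywise_holomorphic (\<lambda>Z. L P Q R (vec_upd S \<mu> Z) x))) \<and>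
     (\<forall>x. L 0 0 0 0 x = 0)"

text \<open>The derivatives \<open>\<L>\<^sup>(\<^sup>o\<^sup>)\<close>, \<open>\<L>\<^sup>(\<^sup>o\<^sup>\<star>\<^sup>)\<close>, \<open>\<L>\<^sup>(\<^sup>\<mu>\<^sup>)\<close>, \<open>\<L>\<^sup>(\<^sup>\<mu>\<^sup>\<star>\<^sup>)\<close> with respect to
  \<open>P\<close>, \<open>Q\<^sup>\<top>\<close>, \<open>R\<^sub>\<mu>\<close>, \<open>S\<^sub>\<mu>\<^sup>\<top>\<close>; the formal arguments \<open>Q\<close>, \<open>S\<close> below are the transposed matrices.\<close>

definition L_o :: "('n::finite, 'r::finite, 'c::finite, complex) jet_fun \<Rightarrow> ('n, 'r, 'c, complex^'r^'c) jet_fun" where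
  "L_o L P Q R S x = mat_deriv (\<lambda>Z. L Z Q R S x) P"

definition L_o_star :: "('n::finite, 'r::finite, 'c::finite, complex) jet_fun \<Rightarrow> ('n, 'r, 'c, complex^'c^'r) jet_fun" where
  "L_o_star L P Q R S x = mat_deriv (\<lambda>Z. L P Z R S x) Q"

definition L_mu :: "('n::finite, 'r::finite, 'c::finite, complex) jet_fun \<Rightarrow> 'n \<Rightarrow> ('n, 'r, 'c, complex^'r^'c) jet_fun" where
  "L_mu L \<mu> P Q R S x = mat_deriv (\<lambda>Z. L P Q (vec_upd R \<mu> Z) S x) (R $ \<mu>)"

definition L_mu_star :: "('n::finite, 'r::finite, 'c::finite, complex) jet_fun \<Rightarrow> 'n \<Rightarrow> ('n, 'r, 'c, complex^'c^'r) jet_fun" where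
  "L_mu_star L \<mu> P Q R S x = mat_deriv (\<lambda>Z. L P Q R (vec_upd S \<mu> Z) x) (S $ \<mu>)"

definition along :: "('n::finite, 'r::finite, 'c::finite, 'v) jet_fun
    \<Rightarrow> (real^'n \<Rightarrow> complex^'c^'r) \<Rightarrow> real^'n \<Rightarrow> 'v" where
  "along G \<Psi> x = G (\<Psi> x) (dagger (\<Psi> x)) (\<chi> \<mu>. partial \<mu> \<Psi> x)
                   (\<chi> \<mu>. partial \<mu> (\<lambda>y. dagger (\<Psi> y)) x) x"

definition EL_solution :: "('n::finite, 'r::finite, 'c::finite, complex) jet_fun
    \<Rightarrow> (real^'n \<Rightarrow> complex^'c^'r) \<Rightarrow> bool" where
  "EL_solution L \<Psi> \<longleftrightarrow>
     smooth \<Psi> \<and>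
     (\<forall>x. along (L_o L) \<Psi> x - (\<Sum>\<mu>\<in>UNIV. partial \<mu> (along (L_mu L \<mu>) \<Psi>) x) = 0) \<and>
     (\<forall>x. along (L_o_star L) \<Psi> x - (\<Sum>\<mu>\<in>UNIV. partial \<mu> (along (L_mu_star L \<mu>) \<Psi>) x) = 0)"

definition complex_linear :: "(complex^'c^'r \<Rightarrow> complex^'c^'r) \<Rightarrow> bool" where
  "complex_linear K \<longleftrightarrow>
     Vector_Spaces.linear (\<lambda>z. map_matrix ((*) z)) (\<lambda>z. map_matrix ((*) z)) K"

text \<open>The exponential of an endomorphism \<open>A\<close>, evaluated at a vector; \<open>A ^^ n\<close> is the \<open>n\<close>-fold iterate.\<close>

definition op_exp :: "('a::real_normed_vector \<Rightarrow> 'a) \<Rightarrow> 'a \<Rightarrow> 'a" where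
  "op_exp A v = (\<Sum>n. (A ^^ n) v /\<^sub>R fact n)"

definition internal_symmetry :: "('n::finite, 'r::finite, 'c::finite, complex) jet_fun
    \<Rightarrow> (complex^'c^'r \<Rightarrow> complex^'c^'r) \<Rightarrow> bool" where
  "internal_symmetry L K \<longleftrightarrow> (\<forall>P Q x.
     (\<lambda>s. let E = op_exp (\<lambda>M. s *\<^sub>R K M) in
            L (E P) (dagger (E P)) (\<chi> \<mu>. E (Q $ \<mu>)) (\<chi> \<mu>. dagger (E (Q $ \<mu>))) x
          - L P (dagger P) Q (\<chi> \<mu>. dagger (Q $ \<mu>)) x)
       \<in> O[at (0::real)](\<lambda>s. complex_of_real (s ^ 2)))"

definition external_symmetry :: "('n::finite, 'r::finite, 'c::finite, complex) jet_fun
    \<Rightarrow> real^'n \<Rightarrow> bool" where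
  "external_symmetry L a \<longleftrightarrow> (\<forall>P Q x.
     (\<lambda>s. L P (dagger P) Q (\<chi> \<mu>. dagger (Q $ \<mu>)) (x - s *\<^sub>R a)
          - L P (dagger P) Q (\<chi> \<mu>. dagger (Q $ \<mu>)) x)
       \<in> O[at (0::real)](\<lambda>s. complex_of_real (s ^ 2)))"

end

theory Submission
  imports Defs
begin

text \<open>
  Write \<open>D\<close> for the total derivative of \<open>\<L>\<close> on jet space and \<open>V = K\<Psi> - \<partial>\<^sub>a\<Psi>\<close>.  By the
  product rule and the Euler-Lagrange equations, the divergence of the trace term is
  \<open>D(V, V\<^sup>\<dagger>, \<partial>\<^sub>\<mu>V, \<partial>\<^sub>\<mu>V\<^sup>\<dagger>, 0)\<close> along \<open>\<Psi>\<close>, while \<open>\<Sum>\<^sub>\<mu> a\<^sup>\<mu> \<partial>\<^sub>\<mu>\<L>\<^sub>\<Psi>\<close> is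
  \<open>D(\<partial>\<^sub>a\<Psi>, \<partial>\<^sub>a\<Psi>\<^sup>\<dagger>, \<partial>\<^sub>a\<partial>\<^sub>\<mu>\<Psi>, \<partial>\<^sub>a\<partial>\<^sub>\<mu>\<Psi>\<^sup>\<dagger>, a)\<close>.  Since mixed partial derivatives commute, the two
  add up to \<open>D(K\<Psi>, (K\<Psi>)\<^sup>\<dagger>, K\<partial>\<^sub>\<mu>\<Psi>, (K\<partial>\<^sub>\<mu>\<Psi>)\<^sup>\<dagger>, 0) + D(0, 0, 0, 0, a)\<close>, and each summand vanishes
  by the first-order form of the corresponding symmetry.
\<close>

subsection \<open>Symmetry of second derivatives\<close>

text \<open>The mean value theorem is applied twice: along \<open>u\<close> to the increment of
  \<open>f\<close> over the step \<open>h *\<^sub>R v\<close>, then along \<open>v\<close> to the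
  derivative in direction \<open>u\<close>. The second difference is symmetric in \<open>u\<close>
  and \<open>v\<close>, so it can be compared with the version in which they are exchanged.\<close>

lemma second_difference_mean_value:
  fixes f :: "'a::real_normed_vector \<Rightarrow> real"
  assumes f: "\<And>y. (f has_derivative f' y) (at y)"
    and fu: "\<And>y. ((\<lambda>y. f' y u) has_derivative fu y) (at y)"
    and h: "h > 0"
  shows "\<exists>\<xi> \<eta>. 0 \<le> \<xi> \<and> \<xi> \<le> h \<and> 0 \<le> \<eta> \<and> \<eta> \<le> h \<and>
    f (x + h *\<^sub>R u + h *\<^sub>R v) - f (x + h *\<^sub>R u) - f (x + h *\<^sub>R v) + f x
      = h\<^sup>2 * fu (x + \<xi> *\<^sub>R u + \<eta> *\<^sub>R v) v"
proof -
  have lin: "linear (f' y)" "linear (fu y)" for y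
    using f fu has_derivative_linear by blast+
  define \<phi> where "\<phi> = (\<lambda>s. f (x + s *\<^sub>R u + h *\<^sub>R v) - f (x + s *\<^sub>R u))"
  have d\<phi>: "(\<phi> has_derivative (\<lambda>t. f' (x + s *\<^sub>R u + h *\<^sub>R v) (t *\<^sub>R u) - f' (x + s *\<^sub>R u) (t *\<^sub>R u)))
    (at s within {0..h})" for s
    unfolding \<phi>_def
    by (rule derivative_eq_intros has_derivative_compose[OF _ f] refl | simp)+
  obtain \<xi> where \<xi>: "\<xi> \<in> {0<..<h}"
    "\<phi> h - \<phi> 0 = f' (x + \<xi> *\<^sub>R u + h *\<^sub>R v) ((h - 0) *\<^sub>R u) - f' (x + \<xi> *\<^sub>R u) ((h - 0) *\<^sub>R u)"
    using mvt_simple[OF h d\<phi>] by blast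
  define \<psi> where "\<psi> = (\<lambda>t. f' (x + \<xi> *\<^sub>R u + t *\<^sub>R v) u)"
  have d\<psi>: "(\<psi> has_derivative (\<lambda>s. fu (x + \<xi> *\<^sub>R u + t *\<^sub>R v) (s *\<^sub>R v))) (at t within {0..h})" for t
    unfolding \<psi>_def
    by (rule derivative_eq_intros has_derivative_compose[OF _ fu] refl | simp)+
  obtain \<eta> where \<eta>: "\<eta> \<in> {0<..<h}"
    "\<psi> h - \<psi> 0 = fu (x + \<xi> *\<^sub>R u + \<eta> *\<^sub>R v) ((h - 0) *\<^sub>R v)"
    using mvt_simple[OF h d\<psi>] by blast
  have "f (x + h *\<^sub>R u + h *\<^sub>R v) - f (x + h *\<^sub>R u) - f (x + h *\<^sub>R v) + f x = \<phi> h - \<phi> 0"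
    by (simp add: \<phi>_def)
  also have "\<dots> = h * (\<psi> h - \<psi> 0)"
    unfolding \<xi>(2) by (simp add: \<psi>_def linear_scale[OF lin(1)] right_diff_distrib)
  also have "\<dots> = h\<^sup>2 * fu (x + \<xi> *\<^sub>R u + \<eta> *\<^sub>R v) v"
    unfolding \<eta>(2) by (simp add: linear_scale[OF lin(2)] power2_eq_square)
  finally show ?thesis
    using \<xi>(1) \<eta>(1) by (intro exI[of _ \<xi>] exI[of _ \<eta>]) auto
qed

text \<open>Each mixed derivative, taken at some point of the same shrinking parallelogram, is the
  second difference divided by the squared step. Continuity at \<open>x\<close> moves both points to
  \<open>x\<close>.\<close>

lemma mixed_derivatives_eq_real:
  fixes f :: "'a::real_normed_vector \<Rightarrow> real"
  assumes f: "\<And>y. (f has_derivative f' y) (at y)"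
    and fu: "\<And>y. ((\<lambda>y. f' y u) has_derivative fu y) (at y)"
    and fv: "\<And>y. ((\<lambda>y. f' y v) has_derivative fv y) (at y)"
    and cu: "isCont (\<lambda>y. fu y v) x"
    and cv: "isCont (\<lambda>y. fv y u) x"
  shows "fu x v = fv x u"
proof -
  define h :: "nat \<Rightarrow> real" where "h n = inverse (real (Suc n))" for n
  have h0: "h \<longlonglongrightarrow> 0"
    unfolding h_def by (rule LIMSEQ_inverse_real_of_nat)
  have hpos: "h n > 0" for n
    by (simp add: h_def)
  have "\<exists>\<xi> \<eta> \<xi>' \<eta>'. 0 \<le> \<xi> \<and> \<xi> \<le> h n \<and> 0 \<le> \<eta> \<and> \<eta> \<le> h n
      \<and> 0 \<le> \<xi>' \<and> \<xi>' \<le> h n \<and> 0 \<le> \<eta>' \<and> \<eta>' \<le> h n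
      \<and> fu (x + \<xi> *\<^sub>R u + \<eta> *\<^sub>R v) v = fv (x + \<xi>' *\<^sub>R v + \<eta>' *\<^sub>R u) u" for n
  proof -
    obtain \<xi> \<eta> where 1: "0 \<le> \<xi>" "\<xi> \<le> h n" "0 \<le> \<eta>" "\<eta> \<le> h n"
      "f (x + h n *\<^sub>R u + h n *\<^sub>R v) - f (x + h n *\<^sub>R u) - f (x + h n *\<^sub>R v) + f x
        = (h n)\<^sup>2 * fu (x + \<xi> *\<^sub>R u + \<eta> *\<^sub>R v) v"
      using second_difference_mean_value[OF f fu hpos[of n], where x = x and v = v] by blast
    obtain \<xi>' \<eta>' where 2: "0 \<le> \<xi>'" "\<xi>' \<le> h n" "0 \<le> \<eta>'" "\<eta>' \<le> h n"
      "f (x + h n *\<^sub>R v + h n *\<^sub>R u) - f (x + h n *\<^sub>R v) - f (x + h n *\<^sub>R u) + f x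
        = (h n)\<^sup>2 * fv (x + \<xi>' *\<^sub>R v + \<eta>' *\<^sub>R u) u"
      using second_difference_mean_value[OF f fv hpos[of n], where x = x and v = u] by blast
    have "(h n)\<^sup>2 * fu (x + \<xi> *\<^sub>R u + \<eta> *\<^sub>R v) v = (h n)\<^sup>2 * fv (x + \<xi>' *\<^sub>R v + \<eta>' *\<^sub>R u) u"
      unfolding 1(5)[symmetric] 2(5)[symmetric] by (simp add: add_ac)
    with hpos[of n] have "fu (x + \<xi> *\<^sub>R u + \<eta> *\<^sub>R v) v = fv (x + \<xi>' *\<^sub>R v + \<eta>' *\<^sub>R u) u"
      by simp
    with 1 2 show ?thesis by blast
  qed
  then obtain \<xi> \<eta> \<xi>' \<eta>' where *:
    "\<And>n. 0 \<le> \<xi> n \<and> \<xi> n \<le> h n" "\<And>n. 0 \<le> \<eta> n \<and> \<eta> n \<le> h n"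
    "\<And>n. 0 \<le> \<xi>' n \<and> \<xi>' n \<le> h n" "\<And>n. 0 \<le> \<eta>' n \<and> \<eta>' n \<le> h n"
    "\<And>n. fu (x + \<xi> n *\<^sub>R u + \<eta> n *\<^sub>R v) v = fv (x + \<xi>' n *\<^sub>R v + \<eta>' n *\<^sub>R u) u"
    by metis
  have lim: "k \<longlonglongrightarrow> 0" if "\<And>n. 0 \<le> k n \<and> k n \<le> h n" for k
    by (rule tendsto_sandwich[OF _ _ tendsto_const h0]) (use that in auto)
  have pts: "(\<lambda>n. x + k n *\<^sub>R w + l n *\<^sub>R z) \<longlonglongrightarrow> x" if "k \<longlonglongrightarrow> 0" "l \<longlonglongrightarrow> 0" for k l w z
    using tendsto_add[OF tendsto_add[OF tendsto_const[of x] tendsto_scaleR[OF that(1) tendsto_const[of w]]]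
      tendsto_scaleR[OF that(2) tendsto_const[of z]]] by simp
  have "(\<lambda>n. fu (x + \<xi> n *\<^sub>R u + \<eta> n *\<^sub>R v) v) \<longlonglongrightarrow> fu x v"
    by (rule isCont_tendsto_compose[OF cu pts]) (use * lim in blast)+
  moreover have "(\<lambda>n. fv (x + \<xi>' n *\<^sub>R v + \<eta>' n *\<^sub>R u) u) \<longlonglongrightarrow> fv x u"
    by (rule isCont_tendsto_compose[OF cv pts]) (use * lim in blast)+
  ultimately show ?thesis
    unfolding *(5) by (rule LIMSEQ_unique)
qed

lemma Ck_SucD:
  assumes "Ck (Suc k) f"
  shows "(f has_derivative frechet_derivative f (at x)) (at x)"
    and "Ck k (\<lambda>x. frechet_derivative f (at x) v)"
  using assms by (auto simp: frechet_derivative_works)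

text \<open>Pairing with a basis vector reduces the claim to real-valued functions;
  \<open>Ck 2\<close> supplies the derivatives and their continuity.\<close>

lemma second_derivative_symmetric:
  fixes f :: "'a::real_normed_vector \<Rightarrow> 'b::euclidean_space"
  assumes "Ck 2 f"
  shows "frechet_derivative (\<lambda>y. frechet_derivative f (at y) u) (at x) v
    = frechet_derivative (\<lambda>y. frechet_derivative f (at y) v) (at x) u"
proof (rule euclidean_eqI)
  fix b :: 'b
  assume "b \<in> Basis"
  have 2: "Ck (Suc (Suc 0)) f"
    using assms by (simp add: numeral_2_eq_2)
  note d1 = Ck_SucD(1)[OF 2] and d2 = Ck_SucD(1)[OF Ck_SucD(2)[OF 2]]
  have c: "isCont (\<lambda>y. frechet_derivative (\<lambda>y. frechet_derivative f (at y) w) (at y) z \<bullet> b) x" for w z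
    using Ck_SucD(2)[OF Ck_SucD(2)[OF 2], of w z]
    by (intro continuous_intros) (simp add: continuous_on_eq_continuous_at)
  show "frechet_derivative (\<lambda>y. frechet_derivative f (at y) u) (at x) v \<bullet> b
    = frechet_derivative (\<lambda>y. frechet_derivative f (at y) v) (at x) u \<bullet> b"
    by (rule mixed_derivatives_eq_real[where f = "\<lambda>y. f y \<bullet> b"
        and f' = "\<lambda>y w. frechet_derivative f (at y) w \<bullet> b"])
      (intro has_derivative_inner_left d1 d2 c)+
qed

subsection \<open>Derivatives of matrix functions\<close>

lemma partial_has_derivative:
  assumes "(f has_derivative f') (at x)"
  shows "partial \<mu> f x = f' (axis \<mu> 1)"
proof -
  have "((\<lambda>t. x + t *\<^sub>R axis \<mu> 1) has_vector_derivative axis \<mu> 1) (at 0)"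
    by (auto intro!: derivative_eq_intros)
  moreover have "(f has_derivative f') (at (x + 0 *\<^sub>R axis \<mu> 1))"
    using assms by simp
  ultimately have "((\<lambda>t. f (x + t *\<^sub>R axis \<mu> 1)) has_vector_derivative f' (axis \<mu> 1)) (at 0)"
    using vector_derivative_diff_chain_within[of _ _ 0 UNIV f f']
    by (simp add: o_def has_derivative_at_withinI)
  then show ?thesis
    unfolding partial_def by (rule vector_derivative_at)
qed

lemma dagger_nth: "dagger A $ i $ j = cnj (A $ j $ i)"
  by (simp add: dagger_def map_matrix_def transpose_def)

lemma bounded_linear_dagger: "bounded_linear dagger"
  by (rule linear_conv_bounded_linear[THEN iffD1], rule linearI)
    (simp_all add: vec_eq_iff dagger_nth)

text \<open>Makes the product rule available for the trace pairings in the conserved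
  current.\<close>

lemma bounded_bilinear_trace_mul:
  "bounded_bilinear (\<lambda>(A::complex^'q^'p) (B::complex^'p^'q). trace (A ** B))"
  unfolding bilinear_conv_bounded_bilinear[symmetric] bilinear_def
  by (auto intro!: linearI simp: trace_def matrix_matrix_mult_def algebra_simps sum.distrib
      scaleR_sum_right)

lemma bounded_linear_axis: "bounded_linear (axis i :: 'a::euclidean_space \<Rightarrow> 'a^'n)"
  by (rule linear_conv_bounded_linear[THEN iffD1], rule linearI)
    (simp_all add: vec_eq_iff axis_def)

lemma matrix_expansion:
  "(A :: complex^'q^'p) = (\<Sum>i\<in>UNIV. \<Sum>j\<in>UNIV. axis i (axis j (A $ i $ j)))"
proof -
  have "(\<Sum>i\<in>UNIV. \<Sum>j\<in>UNIV. axis i (axis j (A $ i $ j))) $ k $ l = A $ k $ l" for k l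
  proof -
    have "(\<Sum>i\<in>UNIV. \<Sum>j\<in>UNIV. axis i (axis j (A $ i $ j))) $ k $ l
      = (\<Sum>i\<in>UNIV. if i = k then (\<Sum>j\<in>UNIV. if j = l then A $ i $ j else 0) else 0)"
      unfolding sum_component by (intro sum.cong refl) (auto simp: axis_def intro!: sum.cong)
    then show ?thesis by simp
  qed
  then show ?thesis by (simp add: vec_eq_iff)
qed

text \<open>A priori \<open>F'\<close> is only real linear. Along a single entry it agrees, by
  uniqueness of derivatives, with multiplication by the complex derivative; expanding
  \<open>V\<close> into its entries then determines \<open>F'\<close>.\<close>

lemma mat_deriv_has_derivative:
  fixes F :: "complex^'q^'p \<Rightarrow> complex"
  assumes F: "(F has_derivative F') (at Z)" and hol: "entrywise_holomorphic F"
  shows "mat_deriv F Z = (\<chi> i j. F' (axis j (axis i 1)))"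
    and "F' V = trace (mat_deriv F Z ** V)"
proof -
  have entry: "F' (axis j (axis i t)) = mat_deriv F Z $ i $ j * t" for i j t
  proof -
    have "(\<lambda>t. F (Z + axis j (axis i t))) holomorphic_on UNIV"
      using hol by (simp add: entrywise_holomorphic_def)
    then have "((\<lambda>t. F (Z + axis j (axis i t))) has_field_derivative mat_deriv F Z $ i $ j) (at 0)"
      by (simp add: mat_deriv_def holomorphic_derivI)
    then have "((\<lambda>t. F (Z + axis j (axis i t))) has_derivative (\<lambda>t. mat_deriv F Z $ i $ j * t)) (at 0)"
      by (simp add: has_field_derivative_def)
    moreover have "((\<lambda>t. F (Z + axis j (axis i t))) has_derivative (\<lambda>t. F' (axis j (axis i t)))) (at 0)"
    proof (rule has_derivative_compose[where g = F])
      show "((\<lambda>t. Z + axis j (axis i t)) has_derivative (\<lambda>t. axis j (axis i t))) (at 0)"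
        by (auto intro!: derivative_eq_intros bounded_linear.has_derivative[OF bounded_linear_axis])
      show "(F has_derivative F') (at (Z + axis j (axis i 0)))"
        using F by (simp add: axis_eq_0_iff[THEN iffD2])
    qed
    ultimately show ?thesis
      by (metis has_derivative_unique)
  qed
  show "mat_deriv F Z = (\<chi> i j. F' (axis j (axis i 1)))"
    by (simp add: vec_eq_iff entry)
  have lin: "linear F'"
    using F has_derivative_linear by blast
  have "F' V = (\<Sum>i\<in>UNIV. \<Sum>j\<in>UNIV. F' (axis i (axis j (V $ i $ j))))"
    by (subst matrix_expansion[of V]) (simp add: linear_sum[OF lin])
  \<comment> \<open>The transposed indexing of \<open>mat_deriv\<close> makes the double sum over
    entries a trace, once the order of summation is exchanged.\<close>
  also have "\<dots> = trace (mat_deriv F Z ** V)"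
    by (subst sum.swap) (simp add: entry trace_def matrix_matrix_mult_def)
  finally show "F' V = trace (mat_deriv F Z ** V)" .
qed

lemma sum_axis_nth: "(\<Sum>i\<in>UNIV. axis i (f i)) = (\<chi> i. f i)"
  by (simp add: vec_eq_iff axis_def)

lemma has_derivative_vec_lambda:
  fixes f :: "'n::finite \<Rightarrow> 'a::real_normed_vector \<Rightarrow> 'b::euclidean_space"
  assumes "\<And>i. (f i has_derivative f' i) F"
  shows "((\<lambda>x. \<chi> i. f i x) has_derivative (\<lambda>h. \<chi> i. f' i h)) F"
  unfolding sum_axis_nth[symmetric]
  by (intro has_derivative_sum bounded_linear.has_derivative[OF bounded_linear_axis] assms)

text \<open>Collapses coordinate derivatives with weights \<open>a $ \<mu>\<close> into one
  directional derivative along \<open>a\<close>.\<close>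

lemma linear_sum_axis:
  fixes a :: "real^'n" and f :: "real^'n \<Rightarrow> 'b::real_vector"
  assumes "linear f"
  shows "(\<Sum>\<mu>\<in>UNIV. (a $ \<mu>) *\<^sub>R f (axis \<mu> 1)) = f a"
proof -
  have "f a = f (\<Sum>\<mu>\<in>UNIV. (a $ \<mu>) *\<^sub>R axis \<mu> 1)"
    using basis_expansion[of a] by (simp add: scalar_mult_eq_scaleR)
  then show ?thesis
    by (simp add: linear_sum[OF assms] linear_scale[OF assms])
qed

lemma vec_upd_has_derivative:
  fixes R :: "('a::euclidean_space)^'n"
  shows "(vec_upd R \<mu> has_derivative axis \<mu>) (at Z)"
proof -
  \<comment> \<open>Written as an affine function of \<open>Z\<close>, the update shows its linear
    part \<open>axis \<mu>\<close>.\<close>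
  have "vec_upd R \<mu> = (\<lambda>Z. R - axis \<mu> (R $ \<mu>) + axis \<mu> Z)"
    by (auto simp: fun_eq_iff vec_eq_iff vec_upd_def axis_def)
  then show ?thesis
    by (auto intro!: derivative_eq_intros bounded_linear.has_derivative[OF bounded_linear_axis])
qed

lemma vec_upd_self: "vec_upd R \<mu> (R $ \<mu>) = R"
  by (simp add: vec_upd_def vec_eq_iff)

subsection \<open>First-order consequences of an infinitesimal symmetry\<close>

lemma norm_funpow_le:
  fixes A :: "'a::real_normed_vector \<Rightarrow> 'a"
  assumes "\<And>x. norm (A x) \<le> norm x * B" "B \<ge> 0"
  shows "norm ((A ^^ n) x) \<le> norm x * B ^ n"
proof (induction n)
  case (Suc n)
  have "norm ((A ^^ Suc n) x) \<le> norm ((A ^^ n) x) * B"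
    using assms(1)[of "(A ^^ n) x"] by simp
  also have "\<dots> \<le> norm x * B ^ n * B"
    using Suc assms by (intro mult_right_mono)
  finally show ?case by (simp add: mult_ac)
qed simp

text \<open>Paired with a basis vector, the exponential is an everywhere convergent real power
  series in \<open>s\<close>, which may be differentiated term by term; at \<open>s = 0\<close> only
  the coefficient of \<open>s\<close> survives.\<close>

lemma op_exp_has_vector_derivative:
  fixes K :: "'a::euclidean_space \<Rightarrow> 'a"
  assumes "linear K"
  shows "((\<lambda>s. op_exp (\<lambda>M. s *\<^sub>R K M) v) has_vector_derivative K v) (at 0)"
proof -
  have "bounded_linear K"
    using assms by (simp add: linear_conv_bounded_linear)
  then obtain B where B: "B \<ge> 0" "\<And>x. norm (K x) \<le> norm x * B"
    using bounded_linear.nonneg_bounded by blast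
  have pow: "((\<lambda>M. s *\<^sub>R K M) ^^ n) v = s ^ n *\<^sub>R (K ^^ n) v" for s n
    by (induction n) (simp_all add: linear_scale[OF assms])
  \<comment> \<open>The series is dominated by the exponential series of
    \<open>\<bar>s\<bar> * B\<close>, where \<open>B\<close> bounds the operator norm of
    \<open>K\<close>.\<close>
  have summ: "summable (\<lambda>n. (s ^ n *\<^sub>R (K ^^ n) v) /\<^sub>R fact n)" for s
  proof (rule summable_comparison_test'[where N = 0])
    show "summable (\<lambda>n. norm v * ((\<bar>s\<bar> * B) ^ n /\<^sub>R fact n))"
      by (intro summable_mult summable_exp_generic)
    show "norm ((s ^ n *\<^sub>R (K ^^ n) v) /\<^sub>R fact n) \<le> norm v * ((\<bar>s\<bar> * B) ^ n /\<^sub>R fact n)" for n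
      using mult_left_mono[OF norm_funpow_le[OF B(2) B(1), of n v], of "\<bar>s\<bar> ^ n / fact n"]
      by (simp add: power_abs power_mult_distrib divide_simps mult_ac)
  qed
  show ?thesis
    unfolding has_vector_derivative_def
  proof (subst has_derivative_componentwise_within, rule ballI)
    fix b :: 'a
    assume "b \<in> Basis"
    define c where "c n = ((K ^^ n) v \<bullet> b) / fact n" for n
    have sums: "(\<lambda>n. c n * s ^ n) sums (op_exp (\<lambda>M. s *\<^sub>R K M) v \<bullet> b)" for s
      using bounded_linear.sums[OF bounded_linear_inner_left[of b] summable_sums[OF summ[of s]]]
      by (simp add: op_exp_def pow c_def divide_simps mult_ac)
    have diffs: "diffs c 0 = K v \<bullet> b"
      by (simp add: diffs_def c_def)
    have "((\<lambda>s. \<Sum>n. c n * s ^ n) has_field_derivative (\<Sum>n. diffs c n * 0 ^ n)) (at 0)"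
      by (rule termdiffs_strong_converges_everywhere) (use sums in \<open>blast intro: sums_summable\<close>)
    then have "((\<lambda>s. op_exp (\<lambda>M. s *\<^sub>R K M) v \<bullet> b) has_field_derivative K v \<bullet> b) (at 0)"
      using sums diffs by (simp add: sums_iff)
    then show "((\<lambda>s. op_exp (\<lambda>M. s *\<^sub>R K M) v \<bullet> b) has_derivative (\<lambda>s. s *\<^sub>R K v \<bullet> b)) (at 0)"
      by (simp add: has_field_derivative_def mult_commute_abs)
  qed
qed

lemma op_exp_zero: "op_exp (\<lambda>M. 0 *\<^sub>R K M) v = v"
proof -
  have "((\<lambda>M. 0) ^^ n) v = (if n = 0 then v else 0)" for n
    by (cases n) auto
  then have "op_exp (\<lambda>M. 0 *\<^sub>R K M) v = (\<Sum>n. if n = 0 then v else 0)"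
    unfolding op_exp_def by (intro suminf_cong) auto
  also have "\<dots> = v"
    using sums_unique[OF sums_single[of 0 "\<lambda>_. v"]] by simp
  finally show ?thesis .
qed

text \<open>After division by \<open>s\<close> the increment is still \<open>O(s)\<close>, so the
  difference quotient tends to 0. This turns the symmetry hypotheses, which hold only up to
  \<open>O(s^2)\<close>, into exact equations.\<close>

lemma vector_derivative_zero_if_bigo_square:
  fixes f :: "real \<Rightarrow> complex"
  assumes "(f has_vector_derivative d) (at 0)"
    and "(\<lambda>s. f s - f 0) \<in> O[at 0](\<lambda>s. complex_of_real (s\<^sup>2))"
  shows "d = 0"
proof -
  obtain C where C: "\<forall>\<^sub>F s in at 0. norm (f s - f 0) \<le> C * norm (complex_of_real (s\<^sup>2))"
    using assms(2) by (elim landau_o.bigE)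
  have der: "((\<lambda>s. norm (f s - f 0 - s *\<^sub>R d) / norm s) \<longlongrightarrow> 0) (at 0)"
    using assms(1) by (simp add: has_vector_derivative_def has_derivative_at)
  \<comment> \<open>The constant \<open>d\<close> is bounded by quantities that vanish in the limit;
    uniqueness of limits then gives \<open>d = 0\<close>.\<close>
  have "((\<lambda>s::real. d) \<longlongrightarrow> 0) (at 0)"
  proof (rule Lim_null_comparison)
    show "\<forall>\<^sub>F s in at 0. norm d \<le> norm (f s - f 0 - s *\<^sub>R d) / norm s + C * \<bar>s\<bar>"
      using C eventually_neq_at_within[of "0::real" 0 UNIV]
    proof eventually_elim
      case (elim s)
      have "\<bar>s\<bar> * norm d \<le> norm (f s - f 0 - s *\<^sub>R d) + norm (f s - f 0)"
        using norm_triangle_ineq4[of "f s - f 0" "f s - f 0 - s *\<^sub>R d"] by simp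
      also have "\<dots> \<le> norm (f s - f 0 - s *\<^sub>R d) + C * \<bar>s\<bar>\<^sup>2"
        using elim by (simp add: norm_power)
      finally show ?case
        using elim(2) by (simp add: field_simps power2_eq_square)
    qed
    show "((\<lambda>s. norm (f s - f 0 - s *\<^sub>R d) / norm s + C * \<bar>s\<bar>) \<longlongrightarrow> 0) (at 0)"
      by (rule tendsto_eq_intros der refl | simp)+
  qed
  with tendsto_const show ?thesis
    by (rule tendsto_unique[rotated]) simp
qed

subsection \<open>The total derivative of the Lagrangian\<close>

text \<open>With all five arguments gathered in one normed space, every partial derivative of
  \<open>L\<close> is a value of a single linear map.\<close>

definition uncurry_jet ::
  "('n::finite, 'r::finite, 'c::finite, 'v) jet_fun \<Rightarrow>
    (complex^'c^'r) \<times> (complex^'r^'c) \<times> ((complex^'c^'r)^'n) \<times> ((complex^'r^'c)^'n) \<times> (real^'n) \<Rightarrow> 'v"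
  where "uncurry_jet G = (\<lambda>(P, Q, R, S, x). G P Q R S x)"

lemma uncurry_jet_simp [simp]: "uncurry_jet G (P, Q, R, S, x) = G P Q R S x"
  by (simp add: uncurry_jet_def)

abbreviation jet_deriv where
  "jet_deriv L p \<equiv> frechet_derivative (uncurry_jet L) (at p)"

lemma proto_Lagrangian_Ck:
  assumes "proto_Lagrangian L"
  shows "Ck k (uncurry_jet L)"
  using assms by (simp add: proto_Lagrangian_def smooth_def uncurry_jet_def)

lemma jet_has_derivative:
  assumes "proto_Lagrangian L"
  shows "(uncurry_jet L has_derivative jet_deriv L p) (at p)"
  by (rule Ck_SucD(1)[OF proto_Lagrangian_Ck[OF assms]])

text \<open>The chain rule restricts the total derivative to an affine slice, and holomorphy turns
  the restriction into a trace. The other three kinds of slot are treated likewise.\<close>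

lemma jet_deriv_P:
  assumes L: "proto_Lagrangian L"
  shows "jet_deriv L (P, Q, R, S, x) (V, 0, 0, 0, 0) = trace (L_o L P Q R S x ** V)"
proof -
  have "((\<lambda>Z. uncurry_jet L (Z, Q, R, S, x)) has_derivative
      (\<lambda>V. jet_deriv L (P, Q, R, S, x) (V, 0, 0, 0, 0))) (at P)"
    by (rule has_derivative_compose[OF _ jet_has_derivative[OF L]])
      (auto intro!: derivative_eq_intros simp: zero_prod_def)
  then have d: "((\<lambda>Z. L Z Q R S x) has_derivative
      (\<lambda>V. jet_deriv L (P, Q, R, S, x) (V, 0, 0, 0, 0))) (at P)"
    by simp
  have hol: "entrywise_holomorphic (\<lambda>Z. L Z Q R S x)"
    using L by (simp add: proto_Lagrangian_def)
  show "jet_deriv L (P, Q, R, S, x) (V, 0, 0, 0, 0) = trace (L_o L P Q R S x ** V)"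
    using mat_deriv_has_derivative(2)[OF d hol] by (simp add: L_o_def)
qed

lemma jet_deriv_Q:
  assumes L: "proto_Lagrangian L"
  shows "jet_deriv L (P, Q, R, S, x) (0, V, 0, 0, 0) = trace (L_o_star L P Q R S x ** V)"
proof -
  have "((\<lambda>Z. uncurry_jet L (P, Z, R, S, x)) has_derivative
      (\<lambda>V. jet_deriv L (P, Q, R, S, x) (0, V, 0, 0, 0))) (at Q)"
    by (rule has_derivative_compose[OF _ jet_has_derivative[OF L]])
      (auto intro!: derivative_eq_intros simp: zero_prod_def)
  then have d: "((\<lambda>Z. L P Z R S x) has_derivative
      (\<lambda>V. jet_deriv L (P, Q, R, S, x) (0, V, 0, 0, 0))) (at Q)"
    by simp
  have hol: "entrywise_holomorphic (\<lambda>Z. L P Z R S x)"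
    using L by (simp add: proto_Lagrangian_def)
  show "jet_deriv L (P, Q, R, S, x) (0, V, 0, 0, 0) = trace (L_o_star L P Q R S x ** V)"
    using mat_deriv_has_derivative(2)[OF d hol] by (simp add: L_o_star_def)
qed

text \<open>The first equation expresses \<open>L_mu\<close> through derivatives of \<open>L\<close>
  in fixed directions, from which its own differentiability is deduced later; the second is the
  trace pairing.\<close>

lemma
  assumes L: "proto_Lagrangian L"
  shows L_mu_eq: "L_mu L \<mu> P Q R S x = (\<chi> i j. jet_deriv L (P, Q, R, S, x) (0, 0, axis \<mu> (axis j (axis i 1)), 0, 0))"
    and jet_deriv_R: "jet_deriv L (P, Q, R, S, x) (0, 0, axis \<mu> V, 0, 0) = trace (L_mu L \<mu> P Q R S x ** V)"
proof -
  have "((\<lambda>Z. uncurry_jet L (P, Q, vec_upd R \<mu> Z, S, x)) has_derivative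
      (\<lambda>V. jet_deriv L (P, Q, vec_upd R \<mu> (R $ \<mu>), S, x) (0, 0, axis \<mu> V, 0, 0))) (at (R $ \<mu>))"
    by (rule has_derivative_compose[OF _ jet_has_derivative[OF L]])
      (auto intro!: derivative_eq_intros vec_upd_has_derivative simp: zero_prod_def)
  then have d: "((\<lambda>Z. L P Q (vec_upd R \<mu> Z) S x) has_derivative
      (\<lambda>V. jet_deriv L (P, Q, R, S, x) (0, 0, axis \<mu> V, 0, 0))) (at (R $ \<mu>))"
    by (simp add: vec_upd_self)
  have hol: "entrywise_holomorphic (\<lambda>Z. L P Q (vec_upd R \<mu> Z) S x)"
    using L by (simp add: proto_Lagrangian_def)
  show "L_mu L \<mu> P Q R S x = (\<chi> i j. jet_deriv L (P, Q, R, S, x) (0, 0, axis \<mu> (axis j (axis i 1)), 0, 0))"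
    "jet_deriv L (P, Q, R, S, x) (0, 0, axis \<mu> V, 0, 0) = trace (L_mu L \<mu> P Q R S x ** V)"
    using mat_deriv_has_derivative[OF d hol] by (simp_all add: L_mu_def)
qed

lemma
  assumes L: "proto_Lagrangian L"
  shows L_mu_star_eq: "L_mu_star L \<mu> P Q R S x = (\<chi> i j. jet_deriv L (P, Q, R, S, x) (0, 0, 0, axis \<mu> (axis j (axis i 1)), 0))"
    and jet_deriv_S: "jet_deriv L (P, Q, R, S, x) (0, 0, 0, axis \<mu> V, 0) = trace (L_mu_star L \<mu> P Q R S x ** V)"
proof -
  have "((\<lambda>Z. uncurry_jet L (P, Q, R, vec_upd S \<mu> Z, x)) has_derivative
      (\<lambda>V. jet_deriv L (P, Q, R, vec_upd S \<mu> (S $ \<mu>), x) (0, 0, 0, axis \<mu> V, 0))) (at (S $ \<mu>))"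
    by (rule has_derivative_compose[OF _ jet_has_derivative[OF L]])
      (auto intro!: derivative_eq_intros vec_upd_has_derivative simp: zero_prod_def)
  then have d: "((\<lambda>Z. L P Q R (vec_upd S \<mu> Z) x) has_derivative
      (\<lambda>V. jet_deriv L (P, Q, R, S, x) (0, 0, 0, axis \<mu> V, 0))) (at (S $ \<mu>))"
    by (simp add: vec_upd_self)
  have hol: "entrywise_holomorphic (\<lambda>Z. L P Q R (vec_upd S \<mu> Z) x)"
    using L by (simp add: proto_Lagrangian_def)
  show "L_mu_star L \<mu> P Q R S x = (\<chi> i j. jet_deriv L (P, Q, R, S, x) (0, 0, 0, axis \<mu> (axis j (axis i 1)), 0))"
    "jet_deriv L (P, Q, R, S, x) (0, 0, 0, axis \<mu> V, 0) = trace (L_mu_star L \<mu> P Q R S x ** V)"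
    using mat_deriv_has_derivative[OF d hol] by (simp_all add: L_mu_star_def)
qed

text \<open>Vertical means that the base point \<open>x\<close> is held fixed. Such a direction is a
  sum of directions in single slots, over which the derivative is additive.\<close>

lemma jet_deriv_vertical:
  fixes L :: "('n::finite, 'r::finite, 'c::finite, complex) jet_fun"
  assumes L: "proto_Lagrangian L"
  shows "jet_deriv L (P, Q, R, S, x) (V, W, A, B, 0)
    = trace (L_o L P Q R S x ** V) + trace (L_o_star L P Q R S x ** W)
      + (\<Sum>\<mu>\<in>UNIV. trace (L_mu L \<mu> P Q R S x ** A $ \<mu>) + trace (L_mu_star L \<mu> P Q R S x ** B $ \<mu>))"
proof -
  let ?D = "jet_deriv L (P, Q, R, S, x)"
  have lin: "linear ?D"
    using jet_has_derivative[OF L] has_derivative_linear by blast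
  have "(V, W, A, B, 0 :: real^'n) = (V, 0, 0, 0, 0) + (0, W, 0, 0, 0)
      + (\<Sum>\<mu>\<in>UNIV. (0, 0, axis \<mu> (A $ \<mu>), 0, 0) + (0, 0, 0, axis \<mu> (B $ \<mu>), 0))"
    by (simp add: prod_eq_iff fst_sum snd_sum sum_axis_nth zero_prod_def)
  then show ?thesis
    by (simp only: linear_add[OF lin] linear_sum[OF lin] jet_deriv_P[OF L] jet_deriv_Q[OF L]
        jet_deriv_R[OF L] jet_deriv_S[OF L])
qed

text \<open>Each entry is a derivative of the smooth function \<open>L\<close> in a fixed direction.
  This allows the chain rule for the terms differentiated in the Euler-Lagrange system.\<close>

lemma L_mu_differentiable:
  assumes L: "proto_Lagrangian L"
  shows "uncurry_jet (L_mu L \<mu>) differentiable at p"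
    and "uncurry_jet (L_mu_star L \<mu>) differentiable at p"
proof -
  have "((\<lambda>p. \<chi> i j. jet_deriv L p (v i j)) has_derivative
      (\<lambda>h. \<chi> i j. frechet_derivative (\<lambda>p. jet_deriv L p (v i j)) (at p) h)) (at p)" for v
    by (intro has_derivative_vec_lambda Ck_SucD(1)[OF Ck_SucD(2)[OF proto_Lagrangian_Ck[OF L]]])
  then have diff: "(\<lambda>p. \<chi> i j. jet_deriv L p (v i j)) differentiable at p" for v
    by (rule differentiableI)
  have eq: "uncurry_jet (L_mu L \<mu>)
      = (\<lambda>p. \<chi> i j. jet_deriv L p (0, 0, axis \<mu> (axis j (axis i 1)), 0, 0))"
    "uncurry_jet (L_mu_star L \<mu>)
      = (\<lambda>p. \<chi> i j. jet_deriv L p (0, 0, 0, axis \<mu> (axis j (axis i 1)), 0))"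
    by (auto simp: fun_eq_iff L_mu_eq[OF L] L_mu_star_eq[OF L])
  show "uncurry_jet (L_mu L \<mu>) differentiable at p"
    "uncurry_jet (L_mu_star L \<mu>) differentiable at p"
    unfolding eq by (rule diff)+
qed

section \<open>Symmetries as vanishing directional derivatives on jet space\<close>

lemma complex_linear_imp_linear:
  fixes K :: "complex^'c^'r \<Rightarrow> complex^'c^'r"
  assumes "complex_linear K"
  shows "linear K"
proof (rule linearI)
  interpret Vector_Spaces.linear "\<lambda>z. map_matrix ((*) z)" "\<lambda>z. map_matrix ((*) z)" K
    using assms by (simp add: complex_linear_def)
  show "K (A + B) = K A + K B" for A B
    by (rule add)
  have "map_matrix ((*) (complex_of_real t)) M = t *\<^sub>R M" for t and M :: "complex^'c^'r"
    by (simp add: vec_eq_iff map_matrix_def) (simp add: scaleR_conv_of_real)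
  then show "K (t *\<^sub>R A) = t *\<^sub>R K A" for t A
    using scale[of "complex_of_real t" A] by simp
qed

text \<open>The curve \<open>\<gamma>\<close> is the orbit of a jet under the exponential flow of
  \<open>K\<close>. Its velocity at 0 is the direction in the claim, and \<open>L\<close> is
  stationary along it to first order.\<close>

lemma internal_symmetry_jet_deriv:
  assumes L: "proto_Lagrangian L" and K: "linear K" and sym: "internal_symmetry L K"
  shows "jet_deriv L (P, dagger P, Q, (\<chi> \<mu>. dagger (Q $ \<mu>)), x)
    (K P, dagger (K P), (\<chi> \<mu>. K (Q $ \<mu>)), (\<chi> \<mu>. dagger (K (Q $ \<mu>))), 0) = 0"
proof -
  define E where "E s = op_exp (\<lambda>M. s *\<^sub>R K M)" for s
  define \<gamma> where "\<gamma> s = (E s P, dagger (E s P), (\<chi> \<mu>. E s (Q $ \<mu>)), (\<chi> \<mu>. dagger (E s (Q $ \<mu>))), x)" for s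
  let ?v = "(K P, dagger (K P), (\<chi> \<mu>. K (Q $ \<mu>)), (\<chi> \<mu>. dagger (K (Q $ \<mu>))), 0)"
  \<comment> \<open>Simplifying \<open>0 *\<^sub>R K M\<close> to 0 would destroy the pattern of
    \<open>op_exp_zero\<close>, so that rule is withheld.\<close>
  have \<gamma>0: "\<gamma> 0 = (P, dagger P, Q, (\<chi> \<mu>. dagger (Q $ \<mu>)), x)"
    by (simp add: \<gamma>_def E_def op_exp_zero del: scaleR_zero_left)
  have E: "((\<lambda>s. E s M) has_derivative (\<lambda>t. t *\<^sub>R K M)) (at 0)" for M
    using op_exp_has_vector_derivative[OF K, of M] by (simp add: E_def has_vector_derivative_def)
  have "(\<gamma> has_derivative (\<lambda>t. (t *\<^sub>R K P, dagger (t *\<^sub>R K P), (\<chi> \<mu>. t *\<^sub>R K (Q $ \<mu>)),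
      (\<chi> \<mu>. dagger (t *\<^sub>R K (Q $ \<mu>))), 0))) (at 0)"
    unfolding \<gamma>_def
    by (intro has_derivative_Pair has_derivative_vec_lambda has_derivative_const E
        bounded_linear.has_derivative[OF bounded_linear_dagger])
  also have "(\<lambda>t. (t *\<^sub>R K P, dagger (t *\<^sub>R K P), (\<chi> \<mu>. t *\<^sub>R K (Q $ \<mu>)),
      (\<chi> \<mu>. dagger (t *\<^sub>R K (Q $ \<mu>))), 0)) = (\<lambda>t. t *\<^sub>R ?v)"
    by (auto simp: fun_eq_iff vec_eq_iff linear_scale[OF bounded_linear.linear[OF bounded_linear_dagger]])
  finally have "(\<gamma> has_vector_derivative ?v) (at 0)"
    by (simp add: has_vector_derivative_def)
  then have "((\<lambda>s. uncurry_jet L (\<gamma> s)) has_vector_derivative jet_deriv L (\<gamma> 0) ?v) (at 0)"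
    using vector_derivative_diff_chain_within[of \<gamma> _ 0 UNIV, OF _ has_derivative_at_withinI[OF jet_has_derivative[OF L]]]
    by (simp add: o_def)
  moreover have "(\<lambda>s. uncurry_jet L (\<gamma> s) - uncurry_jet L (\<gamma> 0)) \<in> O[at 0](\<lambda>s. complex_of_real (s\<^sup>2))"
    unfolding \<gamma>0 using sym by (simp add: \<gamma>_def E_def internal_symmetry_def Let_def)
  ultimately have "jet_deriv L (\<gamma> 0) ?v = 0"
    by (rule vector_derivative_zero_if_bigo_square)
  then show ?thesis
    by (simp add: \<gamma>0)
qed

text \<open>Only the base point moves, with velocity \<open>- a\<close>; linearity removes the
  sign.\<close>

lemma external_symmetry_jet_deriv:
  assumes L: "proto_Lagrangian L" and sym: "external_symmetry L a"
  shows "jet_deriv L (P, dagger P, Q, (\<chi> \<mu>. dagger (Q $ \<mu>)), x) (0, 0, 0, 0, a) = 0"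
proof -
  define \<gamma> where "\<gamma> s = (P, dagger P, Q, (\<chi> \<mu>. dagger (Q $ \<mu>)), x - s *\<^sub>R a)" for s
  have lin: "linear (jet_deriv L (\<gamma> 0))"
    using jet_has_derivative[OF L] has_derivative_linear by blast
  have \<gamma>0: "\<gamma> 0 = (P, dagger P, Q, (\<chi> \<mu>. dagger (Q $ \<mu>)), x)"
    by (simp add: \<gamma>_def)
  have "(\<gamma> has_vector_derivative - (0, 0, 0, 0, a)) (at 0)"
    unfolding \<gamma>_def has_vector_derivative_def
    by (auto intro!: derivative_eq_intros simp: zero_prod_def)
  then have "((\<lambda>s. uncurry_jet L (\<gamma> s)) has_vector_derivative jet_deriv L (\<gamma> 0) (- (0, 0, 0, 0, a))) (at 0)"
    using vector_derivative_diff_chain_within[of \<gamma> _ 0 UNIV, OF _ has_derivative_at_withinI[OF jet_has_derivative[OF L]]]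
    by (simp add: o_def)
  moreover have "(\<lambda>s. uncurry_jet L (\<gamma> s) - uncurry_jet L (\<gamma> 0)) \<in> O[at 0](\<lambda>s. complex_of_real (s\<^sup>2))"
    unfolding \<gamma>0 using sym by (simp add: \<gamma>_def external_symmetry_def)
  ultimately have "jet_deriv L (\<gamma> 0) (- (0, 0, 0, 0, a)) = 0"
    by (rule vector_derivative_zero_if_bigo_square)
  then show ?thesis
    unfolding linear_neg[OF lin] by (simp add: \<gamma>0)
qed

subsection \<open>The conservation law\<close>

theorem theorem4p5:
  fixes L :: "('n::finite, 'r::finite, 'c::finite, complex) jet_fun"
    and K :: "complex^'c^'r \<Rightarrow> complex^'c^'r"
    and a :: "real^'n"
    and \<Psi> :: "real^'n \<Rightarrow> complex^'c^'r"
  assumes "proto_Lagrangian L"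
    and "complex_linear K"
    and "internal_symmetry L K"
    and "external_symmetry L a"
    and "EL_solution L \<Psi>"
  shows "\<forall>x. (\<Sum>\<mu>\<in>UNIV. partial \<mu>
           (\<lambda>y. let V = K (\<Psi> y) - (\<Sum>\<nu>\<in>UNIV. (a $ \<nu>) *\<^sub>R partial \<nu> \<Psi> y) in
                 trace (along (L_mu L \<mu>) \<Psi> y ** V)
               + trace (along (L_mu_star L \<mu>) \<Psi> y ** dagger V)
               + complex_of_real (a $ \<mu>) * along L \<Psi> y) x) = 0"
proof
  fix x :: "real^'n"
  have L: "proto_Lagrangian L" and K: "linear K"
    using assms complex_linear_imp_linear by blast+
  have Ck: "Ck k \<Psi>" for k
    using assms(5) by (simp add: EL_solution_def smooth_def)
  define e :: "'n \<Rightarrow> real^'n" where "e \<mu> = axis \<mu> 1" for \<mu>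
  define D where "D y = frechet_derivative \<Psi> (at y)" for y
  define D2 where "D2 \<mu> y = frechet_derivative (\<lambda>y. D y (e \<mu>)) (at y)" for \<mu> y
  \<comment> \<open>\<open>J\<close> will be the derivative of \<open>jet\<close> at
    \<open>x\<close>; its last slot is \<open>h\<close> because the base point is itself a component
    of the jet.\<close>
  define J where "J h = (D x h, dagger (D x h), (\<chi> \<mu>. D2 \<mu> x h), (\<chi> \<mu>. dagger (D2 \<mu> x h)), h)" for h
  define jet where "jet y = (\<Psi> y, dagger (\<Psi> y), (\<chi> \<mu>. D y (e \<mu>)), (\<chi> \<mu>. dagger (D y (e \<mu>))), y)" for y
  \<comment> \<open>\<open>V\<close> is the infinitesimal variation of \<open>\<Psi>\<close> under
    both symmetries combined, and \<open>V'\<close> will be its derivative at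
    \<open>x\<close>.\<close>
  define V where "V y = K (\<Psi> y) - (\<Sum>\<nu>\<in>UNIV. (a $ \<nu>) *\<^sub>R D y (e \<nu>))" for y
  define V' where "V' h = K (D x h) - (\<Sum>\<nu>\<in>UNIV. (a $ \<nu>) *\<^sub>R D2 \<nu> x h)" for h
  note dagger = bounded_linear.has_derivative[OF bounded_linear_dagger]
  have dK: "bounded_linear K"
    using K by (simp add: linear_conv_bounded_linear)
  have d\<Psi>: "(\<Psi> has_derivative D y) (at y)" for y
    unfolding D_def by (rule Ck_SucD(1)[OF Ck])
  have dD: "((\<lambda>y. D y (e \<mu>)) has_derivative D2 \<mu> y) (at y)" for \<mu> y
    unfolding D2_def unfolding D_def by (rule Ck_SucD(1)[OF Ck_SucD(2)[OF Ck]])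
  have D2_sym: "D2 \<mu> x (e \<nu>) = D2 \<nu> x (e \<mu>)" for \<mu> \<nu>
    unfolding D2_def D_def by (rule second_derivative_symmetric[OF Ck])
  have lin: "linear (D x)" "linear (D2 \<mu> x)" for \<mu>
    using d\<Psi> dD has_derivative_linear by blast+
  have partial_\<Psi>: "partial \<mu> \<Psi> y = D y (e \<mu>)" for \<mu> y
    unfolding e_def by (rule partial_has_derivative[OF d\<Psi>])
  have partial_dagger: "partial \<mu> (\<lambda>z. dagger (\<Psi> z)) y = dagger (D y (e \<mu>))" for \<mu> y
    unfolding e_def by (rule partial_has_derivative[OF dagger[OF d\<Psi>]])
  \<comment> \<open>As a composition with \<open>jet\<close>, \<open>along\<close> is open to the
    chain rule. The value type is arbitrary since \<open>G\<close> is \<open>L\<close> as well as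
    its matrix-valued derivatives.\<close>
  have along: "along G \<Psi> = (\<lambda>y. uncurry_jet G (jet y))" for G :: "('n, 'r, 'c, 'v) jet_fun"
    by (simp add: fun_eq_iff along_def jet_def partial_\<Psi> partial_dagger)
  have djet: "(jet has_derivative J) (at x)"
    unfolding jet_def J_def
    by (intro has_derivative_Pair has_derivative_vec_lambda dagger d\<Psi> dD has_derivative_ident)
  have dV: "(V has_derivative V') (at x)"
    unfolding V_def V'_def
    by (intro has_derivative_diff has_derivative_sum has_derivative_scaleR_right d\<Psi> dD
        bounded_linear.has_derivative[OF dK])
  have dL: "((\<lambda>y. uncurry_jet L (jet y)) has_derivative (\<lambda>h. jet_deriv L (jet x) (J h))) (at x)"
    by (rule has_derivative_compose[OF djet jet_has_derivative[OF L]])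
  define A' where "A' \<mu> h = jet_deriv (L_mu L \<mu>) (jet x) (J h)" for \<mu> h
  define B' where "B' \<mu> h = jet_deriv (L_mu_star L \<mu>) (jet x) (J h)" for \<mu> h
  have dA: "((\<lambda>y. uncurry_jet (L_mu L \<mu>) (jet y)) has_derivative A' \<mu>) (at x)"
    and dB: "((\<lambda>y. uncurry_jet (L_mu_star L \<mu>) (jet y)) has_derivative B' \<mu>) (at x)" for \<mu>
    unfolding A'_def B'_def
    using L_mu_differentiable[OF L] by (intro has_derivative_compose[OF djet]; simp add: frechet_derivative_works)+
  define A where "A \<mu> = uncurry_jet (L_mu L \<mu>) (jet x)" for \<mu>
  define B where "B \<mu> = uncurry_jet (L_mu_star L \<mu>) (jet x)" for \<mu>
  \<comment> \<open>The Euler-Lagrange system trades the divergence of the momenta for the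
    derivatives in the undifferentiated slots.\<close>
  have EL: "uncurry_jet (L_o L) (jet x) = (\<Sum>\<mu>\<in>UNIV. A' \<mu> (e \<mu>))"
    "uncurry_jet (L_o_star L) (jet x) = (\<Sum>\<mu>\<in>UNIV. B' \<mu> (e \<mu>))"
    using assms(5) by (simp_all add: EL_solution_def along e_def
        partial_has_derivative[OF dA] partial_has_derivative[OF dB])
  have "partial \<mu>
      (\<lambda>y. let V = K (\<Psi> y) - (\<Sum>\<nu>\<in>UNIV. (a $ \<nu>) *\<^sub>R partial \<nu> \<Psi> y) in
             trace (along (L_mu L \<mu>) \<Psi> y ** V)
           + trace (along (L_mu_star L \<mu>) \<Psi> y ** dagger V)
           + complex_of_real (a $ \<mu>) * along L \<Psi> y) x
    = (trace (A \<mu> ** V' (e \<mu>)) + trace (A' \<mu> (e \<mu>) ** V x))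
      + (trace (B \<mu> ** dagger (V' (e \<mu>))) + trace (B' \<mu> (e \<mu>) ** dagger (V x)))
      + complex_of_real (a $ \<mu>) * jet_deriv L (jet x) (J (e \<mu>))" for \<mu>
    unfolding Let_def along partial_\<Psi> V_def[symmetric] A_def B_def
    by (subst e_def)+ (intro partial_has_derivative has_derivative_add has_derivative_mult_right dL
        bounded_bilinear.FDERIV[OF bounded_bilinear_trace_mul] dA dB dV dagger)
  \<comment> \<open>The terms pairing with the undifferentiated \<open>V x\<close> are collected
    first, so that the Euler-Lagrange system applies to their coefficients.\<close>
  then have "(\<Sum>\<mu>\<in>UNIV. partial \<mu>
      (\<lambda>y. let V = K (\<Psi> y) - (\<Sum>\<nu>\<in>UNIV. (a $ \<nu>) *\<^sub>R partial \<nu> \<Psi> y) in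
             trace (along (L_mu L \<mu>) \<Psi> y ** V)
           + trace (along (L_mu_star L \<mu>) \<Psi> y ** dagger V)
           + complex_of_real (a $ \<mu>) * along L \<Psi> y) x)
    = (\<Sum>\<mu>\<in>UNIV. trace (A' \<mu> (e \<mu>) ** V x)) + (\<Sum>\<mu>\<in>UNIV. trace (B' \<mu> (e \<mu>) ** dagger (V x)))
      + (\<Sum>\<mu>\<in>UNIV. trace (A \<mu> ** V' (e \<mu>)) + trace (B \<mu> ** dagger (V' (e \<mu>))))
      + (\<Sum>\<mu>\<in>UNIV. complex_of_real (a $ \<mu>) * jet_deriv L (jet x) (J (e \<mu>)))"
    by (simp add: sum.distrib)
  also have "\<dots> = jet_deriv L (jet x) (V x, dagger (V x), (\<chi> \<mu>. V' (e \<mu>)), (\<chi> \<mu>. dagger (V' (e \<mu>))), 0)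
      + jet_deriv L (jet x) (J a)"
  proof -
    have linL: "linear (jet_deriv L (jet x))" and linJ: "linear J"
      using jet_has_derivative[OF L] djet has_derivative_linear by blast+
    have 1: "jet_deriv L (jet x) (J a)
      = (\<Sum>\<mu>\<in>UNIV. complex_of_real (a $ \<mu>) * jet_deriv L (jet x) (J (e \<mu>)))"
      using linear_sum_axis[OF linear_compose[OF linJ linL], of a] by (simp add: e_def scaleR_conv_of_real)
    \<comment> \<open>The dimensions are generic because the sums of \<open>A'\<close> and of
      \<open>B'\<close> have transposed shapes.\<close>
    have tr: "trace ((\<Sum>\<mu>\<in>UNIV. M \<mu>) ** W) = (\<Sum>\<mu>\<in>UNIV. trace (M \<mu> ** W))"
      for M :: "'n \<Rightarrow> complex^'q::finite^'p::finite" and W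
      by (rule bounded_bilinear.sum_left[OF bounded_bilinear_trace_mul])
    have 2: "jet_deriv L (jet x) (V x, dagger (V x), (\<chi> \<mu>. V' (e \<mu>)), (\<chi> \<mu>. dagger (V' (e \<mu>))), 0)
      = trace (uncurry_jet (L_o L) (jet x) ** V x) + trace (uncurry_jet (L_o_star L) (jet x) ** dagger (V x))
        + (\<Sum>\<mu>\<in>UNIV. trace (A \<mu> ** V' (e \<mu>)) + trace (B \<mu> ** dagger (V' (e \<mu>))))"
      unfolding A_def B_def jet_def by (simp add: jet_deriv_vertical[OF L])
    show ?thesis
      unfolding 1 2 EL tr ..
  qed
  also have "\<dots> = jet_deriv L (jet x)
      (K (\<Psi> x), dagger (K (\<Psi> x)), (\<chi> \<mu>. K (D x (e \<mu>))), (\<chi> \<mu>. dagger (K (D x (e \<mu>)))), 0)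
      + jet_deriv L (jet x) (0, 0, 0, 0, a)"
  proof -
    have linL: "linear (jet_deriv L (jet x))"
      using jet_has_derivative[OF L] has_derivative_linear by blast
    note comb = linear_sum_axis[where a = a, folded e_def]
    have "V x = K (\<Psi> x) - D x a"
      by (simp add: V_def comb[OF lin(1)])
    \<comment> \<open>Commuting mixed derivatives turns the \<open>\<mu>\<close>-derivative of the
      transport term into the derivative of the \<open>\<mu>\<close>-th partial along
      \<open>a\<close>.\<close>
    moreover have "V' (e \<mu>) = K (D x (e \<mu>)) - D2 \<mu> x a" for \<mu>
      unfolding V'_def D2_sym[of _ \<mu>] by (simp add: comb[OF lin(2)])
    \<comment> \<open>The transport terms in \<open>V\<close> and \<open>V'\<close> cancel the first
      four slots of \<open>J a\<close>, leaving the internal direction and the pure translation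
      \<open>a\<close>.\<close>
    ultimately have "(V x, dagger (V x), (\<chi> \<mu>. V' (e \<mu>)), (\<chi> \<mu>. dagger (V' (e \<mu>))), 0) + J a
      = (K (\<Psi> x), dagger (K (\<Psi> x)), (\<chi> \<mu>. K (D x (e \<mu>))), (\<chi> \<mu>. dagger (K (D x (e \<mu>)))), 0)
        + (0, 0, 0, 0, a)"
      by (simp add: J_def vec_eq_iff dagger_nth)
    then show ?thesis
      by (simp only: linear_add[OF linL, symmetric])
  qed
  \<comment> \<open>The symmetries constrain \<open>L\<close> only where the starred slots are the
    daggers of the others; \<open>jet x\<close> is such a point.\<close>
  also have "\<dots> = 0"
    using internal_symmetry_jet_deriv[OF L K assms(3), of "\<Psi> x" "\<chi> \<mu>. D x (e \<mu>)" x]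
      external_symmetry_jet_deriv[OF L assms(4), of "\<Psi> x" "\<chi> \<mu>. D x (e \<mu>)" x]
    by (simp add: jet_def)
  finally show "(\<Sum>\<mu>\<in>UNIV. partial \<mu>
           (\<lambda>y. let V = K (\<Psi> y) - (\<Sum>\<nu>\<in>UNIV. (a $ \<nu>) *\<^sub>R partial \<nu> \<Psi> y) in
                 trace (along (L_mu L \<mu>) \<Psi> y ** V)
               + trace (along (L_mu_star L \<mu>) \<Psi> y ** dagger V)
               + complex_of_real (a $ \<mu>) * along L \<Psi> y) x) = 0" .
qed

end
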